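(* Let $r \in \mathbb{N}$ with $r \geq 2$, let $p \in (0,1)$, and let $\gamma = p/(1-p)$. Let $N_1$ be the number of samples of an i.i.d. Bernoulli($p$) sequence observed until exactly $r+1$ successes have occurred, and let $N_2$ be the number of samples of a second i.i.d. Bernoulli($p$) sequence, independent of the first, observed until exactly $r-1$ failures have occurred. Define $$\hat\gamma = \frac{r}{N_1-1}\cdot\frac{N_2}{r-1}, \qquad N = N_1+N_2.$$ Then $$\mathrm{E}[\hat\gamma] = \gamma,$$ $$\frac{\mathrm{Var}[\hat\gamma]}{\gamma^2} \leq \frac{1}{r-1}\left(1 - \frac{p(1-p)}{r-1+2p}\right) < \frac{1}{r-1},$$ $$\mathrm{E}[N] = \frac{r+1-2p}{p(1-p)}.$$
   Context: A Bernoulli($p$) variable takes the value "success" with probability $p$ and "failure" with probability $1-p$. The number of samples needed to obtain $m$ successes counts all samples, including the last success, so $\Pr[N_1=n]=\binom{n-1}{r}p^{r+1}(1-p)^{n-r-1}$ for $n\ge r+1$, and $\Pr[N_2=n]=\binom{n-1}{r-2}(1-p)^{r-1}p^{n-r+1}$ for $n\ge r-1$; $N_1$ and $N_2$ are independent. The quantity $\gamma=p/(1-p)$ is called the odds. The estimator $\hat\gamma$ is the product $\hat p_1\hat d_2$ of $\hat p_1=(r_1-1)/(N_1-1)$ with $r_1=r+1$ and $\hat d_2=N_2/r_2$ with $r_2=r-1$. *)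

theory Defs
  imports "HOL-Probability.Probability"
begin

definition iid_bernoulli :: "'a measure \<Rightarrow> real \<Rightarrow> (nat \<Rightarrow> 'a \<Rightarrow> bool) \<Rightarrow> bool" where
  "iid_bernoulli M p X \<longleftrightarrow>
     prob_space.indep_vars M (\<lambda>_. count_space UNIV) X UNIV \<and>
     (\<forall>i. distr M (count_space UNIV) (X i) = measure_pmf (bernoulli_pmf p))"

definition indep_seqs :: "'a measure \<Rightarrow> (nat \<Rightarrow> 'a \<Rightarrow> bool) \<Rightarrow> (nat \<Rightarrow> 'a \<Rightarrow> bool) \<Rightarrow> bool" where
  "indep_seqs M X Y \<longleftrightarrow>
     prob_space.indep_var M
       (\<Pi>\<^sub>M i\<in>UNIV. count_space UNIV) (\<lambda>\<omega> i. X i \<omega>)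
       (\<Pi>\<^sub>M i\<in>UNIV. count_space UNIV) (\<lambda>\<omega> i. Y i \<omega>)"

(* Samples are indexed from 0, so the first n samples are those with index i < n, and the
   least such n counts the sample that produces the k-th occurrence of the outcome b.
   If b occurs fewer than k times, the value is an irrelevant fixed number; for i.i.d.
   Bernoulli samples with 0 < p < 1 this is a null event. *)
definition samples_until :: "bool \<Rightarrow> nat \<Rightarrow> (nat \<Rightarrow> bool) \<Rightarrow> nat" where
  "samples_until b k x = (LEAST n. card {i. i < n \<and> x i = b} = k)"

end

(* The numbers of failures are negative binomial, and the shift identity
   E[J g(J)] = (1 - p) E[(J + k) g(J + 1)] for J ~ NB(k, p) relates the reciprocal moments.
   With n = N_1 - 1 and A_m = E[1 / (n + m)] it yields r A_0 = p,
   A_0 - r E[1 / n^2] = (1 - p) A_1 and (r + 1) A_1 - r A_0 = (1 - p) A_2.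
   Convexity of 1 / x gives A_0 - 2 A_1 + A_2 >= 0; eliminating A_1 and A_2 turns this into
   E[(r / n)^2] <= p^2 (r + p) / (r - 1 + 2 p), which multiplied with the exact second moment of
   N_2 / (r - 1) is precisely the claimed variance bound. *)

theory Submission
  imports Defs
begin

section \<open>Moments and the shift identity of the negative binomial distribution\<close>

lemma sums_expectation_pmf_nat:
  fixes f :: "nat \<Rightarrow> real"
  assumes "integrable (measure_pmf P) f"
  shows "(\<lambda>j. pmf P j * f j) sums measure_pmf.expectation P f"
proof -
  have "integrable (count_space UNIV) (\<lambda>j. pmf P j * f j)"
    using assms by (simp add: measure_pmf_eq_density integrable_density)
  from sums_integral_count_space_nat[OF this] show ?thesis
    by (simp add: measure_pmf_eq_density integral_density)
qed

text \<open>The absorption identity (j + k) * C(j + k - 1, k - 1) = k * C(j + k, k), multiplied by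
  p^k (1 - p)^j. The factor 1 / p supplies the missing power of p in the weight for
  \<open>Suc k\<close>.\<close>

lemma pmf_neg_binomial_size_bias:
  assumes p: "p \<in> {0<..1}" and "k > 0"
  shows "pmf (neg_binomial_pmf k p) j * (real j + real k)
    = real k / p * pmf (neg_binomial_pmf (Suc k) p) j"
proof -
  have "real (j + k) * real ((j + k - 1) choose (k - 1)) = real k * real ((j + k) choose k)"
    using times_binomial_minus1_eq[of k "j + k"] \<open>k > 0\<close> unfolding of_nat_mult[symmetric] by simp
  moreover have "(j + k - 1) choose (k - 1) = (j + k - 1) choose j" "(j + k) choose k = (j + k) choose j"
    using binomial_symmetric[of j "j + k - 1"] binomial_symmetric[of j "j + k"] \<open>k > 0\<close> by simp_all
  ultimately have "real ((j + k - 1) choose j) * (real j + real k) = real k * real ((j + k) choose j)"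
    by (simp add: mult.commute)
  then have "real ((j + k - 1) choose j) * (real j + real k) * (p ^ k * (1 - p) ^ j)
      = real k * real ((j + k) choose j) * (p ^ k * (1 - p) ^ j)"
    by simp
  then show ?thesis
    using p by (simp add: pmf_neg_binomial mult_ac)
qed

text \<open>Size biasing by the number of trials raises the parameter by one, so each further power
  of j + k costs one application. Integrability travels the same way, from \<open>Suc k\<close> down
  to \<open>k\<close>, and no series has to be summed by hand.\<close>

lemma
  fixes f :: "nat \<Rightarrow> real"
  assumes p: "p \<in> {0<..1}" and k: "k > 0" and f: "integrable (neg_binomial_pmf (Suc k) p) f"
  shows integrable_neg_binomial_size_bias:
      "integrable (neg_binomial_pmf k p) (\<lambda>j. (real j + real k) * f j)"
    and expectation_neg_binomial_size_bias:
      "measure_pmf.expectation (neg_binomial_pmf k p) (\<lambda>j. (real j + real k) * f j)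
       = real k / p * measure_pmf.expectation (neg_binomial_pmf (Suc k) p) f"
proof -
  have *: "pmf (neg_binomial_pmf k p) j * ((real j + real k) * f j)
      = real k / p * (pmf (neg_binomial_pmf (Suc k) p) j * f j)" for j
    using pmf_neg_binomial_size_bias[OF p k, of j] by (simp only: mult.assoc[symmetric])
  have "integrable (count_space UNIV) (\<lambda>j. pmf (neg_binomial_pmf (Suc k) p) j * f j)"
    using f by (simp add: measure_pmf_eq_density integrable_density)
  then have "integrable (count_space UNIV) (\<lambda>j. pmf (neg_binomial_pmf k p) j * ((real j + real k) * f j))"
    unfolding * by (rule integrable_mult_right)
  then show "integrable (neg_binomial_pmf k p) (\<lambda>j. (real j + real k) * f j)"
    by (simp add: measure_pmf_eq_density integrable_density)
  show "measure_pmf.expectation (neg_binomial_pmf k p) (\<lambda>j. (real j + real k) * f j)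
       = real k / p * measure_pmf.expectation (neg_binomial_pmf (Suc k) p) f"
    by (simp add: measure_pmf_eq_density integral_density *)
qed

text \<open>The weights w satisfy w (j + 1) * (j + 1) = (1 - p) * w j * (j + k). Multiplying by g (j
  + 1) and summing over j gives the claim.\<close>

lemma expectation_neg_binomial_shift:
  fixes g :: "nat \<Rightarrow> real"
  assumes p: "p \<in> {0<..1}" and k: "k > 0"
    and "integrable (neg_binomial_pmf k p) (\<lambda>j. real j * g j)"
    and "integrable (neg_binomial_pmf k p) (\<lambda>j. (real j + real k) * g (Suc j))"
  shows "measure_pmf.expectation (neg_binomial_pmf k p) (\<lambda>j. real j * g j)
    = (1 - p) * measure_pmf.expectation (neg_binomial_pmf k p) (\<lambda>j. (real j + real k) * g (Suc j))"
proof -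
  let ?w = "pmf (neg_binomial_pmf k p)"
  have *: "?w (Suc j) * real (Suc j) = (1 - p) * (?w j * (real j + real k))" for j
  proof -
    have "Suc j * ((j + k) choose Suc j) = (j + k) * ((j + k - 1) choose j)"
      using Suc_times_binomial[of j "j + k - 1"] k by simp
    then have "real (Suc j) * real ((j + k) choose Suc j) = (real j + real k) * real ((j + k - 1) choose j)"
      by (metis of_nat_add of_nat_mult)
    then have "real (Suc j) * real ((j + k) choose Suc j) * (p ^ k * (1 - p) ^ Suc j)
        = (real j + real k) * real ((j + k - 1) choose j) * (p ^ k * (1 - p) ^ Suc j)"
      by simp
    then show ?thesis
      using p by (simp add: pmf_neg_binomial mult_ac del: of_nat_Suc binomial_Suc_Suc)
  qed
  have eq: "?w (Suc j) * (real (Suc j) * g (Suc j))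
      = (1 - p) * (?w j * ((real j + real k) * g (Suc j)))" for j
    using *[of j] by (simp only: mult.assoc[symmetric])
  \<comment> \<open>Dropping the term at index 0 costs nothing, because the factor
    \<open>real j\<close> makes it vanish.\<close>
  have "(\<lambda>j. ?w (Suc j) * (real (Suc j) * g (Suc j)))
      sums measure_pmf.expectation (neg_binomial_pmf k p) (\<lambda>j. real j * g j)"
    using sums_expectation_pmf_nat[OF assms(3)] by (subst sums_Suc_iff) simp
  moreover have "(\<lambda>j. ?w (Suc j) * (real (Suc j) * g (Suc j))) sums
      ((1 - p) * measure_pmf.expectation (neg_binomial_pmf k p) (\<lambda>j. (real j + real k) * g (Suc j)))"
    unfolding eq by (intro sums_mult sums_expectation_pmf_nat assms)
  ultimately show ?thesis
    by (rule sums_unique2)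
qed

lemma
  assumes p: "p \<in> {0<..1}" and k: "k > 0"
  shows integrable_neg_binomial_trials:
      "integrable (neg_binomial_pmf k p) (\<lambda>j. real j + real k)"
    and expectation_neg_binomial_trials:
      "measure_pmf.expectation (neg_binomial_pmf k p) (\<lambda>j. real j + real k) = real k / p"
  using integrable_neg_binomial_size_bias[OF p k, of "\<lambda>_. 1"]
    expectation_neg_binomial_size_bias[OF p k, of "\<lambda>_. 1"] by simp_all

lemma
  assumes p: "p \<in> {0<..1}" and k: "k > 0"
  shows integrable_neg_binomial_trials_square:
      "integrable (neg_binomial_pmf k p) (\<lambda>j. (real j + real k)\<^sup>2)"
    and expectation_neg_binomial_trials_square:
      "measure_pmf.expectation (neg_binomial_pmf k p) (\<lambda>j. (real j + real k)\<^sup>2)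
       = real k * (real k + 1 - p) / p\<^sup>2"
proof -
  \<comment> \<open>Size biasing one factor of the square leaves j + k under the law with parameter
    \<open>Suc k\<close>, whose number of trials is j + k + 1; hence the correction by 1.\<close>
  have I: "integrable (neg_binomial_pmf (Suc k) p) (\<lambda>j. (real j + real (Suc k)) - 1)"
    by (intro Bochner_Integration.integrable_diff integrable_neg_binomial_trials p) auto
  have "measure_pmf.expectation (neg_binomial_pmf (Suc k) p) (\<lambda>j. (real j + real (Suc k)) - 1)
      = real (Suc k) / p - 1"
    using integrable_neg_binomial_trials[OF p, of "Suc k"]
      expectation_neg_binomial_trials[OF p, of "Suc k"]
    by (subst Bochner_Integration.integral_diff) auto
  then have E: "measure_pmf.expectation (neg_binomial_pmf (Suc k) p) (\<lambda>j. real j + real k)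
      = real (Suc k) / p - 1"
    by (simp add: algebra_simps)
  have I: "integrable (neg_binomial_pmf (Suc k) p) (\<lambda>j. real j + real k)"
    using I by (simp add: algebra_simps)
  show "integrable (neg_binomial_pmf k p) (\<lambda>j. (real j + real k)\<^sup>2)"
    using integrable_neg_binomial_size_bias[OF p k I] by (simp add: power2_eq_square)
  show "measure_pmf.expectation (neg_binomial_pmf k p) (\<lambda>j. (real j + real k)\<^sup>2)
       = real k * (real k + 1 - p) / p\<^sup>2"
    using expectation_neg_binomial_size_bias[OF p k I] E p by (simp add: power2_eq_square field_simps)
qed

section \<open>Reciprocal moments of the number of trials\<close>

lemma
  fixes p :: real and r :: nat
  assumes p: "0 < p" "p < 1" and r: "r \<ge> 1"
  defines "P \<equiv> neg_binomial_pmf (Suc r) p"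
  shows expectation_inverse_trials:
      "measure_pmf.expectation P (\<lambda>j. real r / (real j + real r)) = p"
    and expectation_inverse_trials_square_le:
      "measure_pmf.expectation P (\<lambda>j. (real r / (real j + real r))\<^sup>2)
         \<le> p\<^sup>2 * (real r + p) / (real r - 1 + 2 * p)"
proof -
  define A where "A m = measure_pmf.expectation P (\<lambda>j. 1 / (real j + real r + m))" for m :: real
  define B where "B = measure_pmf.expectation P (\<lambda>j. 1 / (real j + real r)\<^sup>2)"
  have p1: "p \<in> {0<..1}" using p by auto
  \<comment> \<open>All reciprocals and quotients below are bounded by 1, since j + r is at least 1,
    so boundedness settles every integrability condition.\<close>
  have int: "integrable P f" if "\<And>j. \<bar>f j\<bar> \<le> 1" for f :: "nat \<Rightarrow> real"
    using that by (intro measure_pmf.integrable_const_bound[where B = 1]) auto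
  have pos: "real j + real r \<ge> 1" for j using r by auto
  have iA [simp]: "integrable P (\<lambda>j. 1 / (real j + real r + m))" if "m \<ge> 0" for m
  proof (intro int)
    fix j show "\<bar>1 / (real j + real r + m)\<bar> \<le> 1"
      using that pos[of j] by simp
  qed
  have iA0 [simp]: "integrable P (\<lambda>j. 1 / (real j + real r))"
    using iA[of 0] by simp
  have iB [simp]: "integrable P (\<lambda>j. 1 / (real j + real r)\<^sup>2)"
  proof (intro int)
    fix j show "\<bar>1 / (real j + real r)\<^sup>2\<bar> \<le> 1"
      using one_le_power[OF pos[of j], of 2] by (simp add: divide_le_eq_1)
  qed
  have quot: "\<bar>a * (1 / b)\<bar> \<le> 1" if "0 \<le> a" "a \<le> b" for a b :: real
    using that by (auto simp: divide_le_eq_1)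
  have shift: "measure_pmf.expectation P (\<lambda>j. real j * g j)
      = (1 - p) * measure_pmf.expectation P (\<lambda>j. (real j + real (Suc r)) * g (Suc j))"
    if "\<And>j. \<bar>real j * g j\<bar> \<le> 1" "\<And>j. \<bar>(real j + real (Suc r)) * g (Suc j)\<bar> \<le> 1" for g
    using that int unfolding P_def by (intro expectation_neg_binomial_shift p1) auto

  text \<open>Each relation below is the shift identity with \<open>g j = f j / (j + r)\<close>, for
    \<open>f = 1\<close>, \<open>f j = 1 / (j + r)\<close> and \<open>f j = 1 / (j + r + 1)\<close>.\<close>
  have "1 - real r * A 0 = 1 - p"
  proof -
    have "1 - real r * A 0 = measure_pmf.expectation P (\<lambda>j. 1 - real r * (1 / (real j + real r)))"
      unfolding A_def by (subst Bochner_Integration.integral_diff) (simp_all del: times_divide_eq_right)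
    also have "\<dots> = measure_pmf.expectation P (\<lambda>j. real j * (1 / (real j + real r)))"
      using r by (intro Bochner_Integration.integral_cong) (auto simp: field_simps)
    also have "\<dots> = (1 - p) * measure_pmf.expectation P (\<lambda>j. (real j + real (Suc r)) * (1 / (real (Suc j) + real r)))"
      using r by (intro shift) (auto simp: field_simps)
    \<comment> \<open>The law has parameter r + 1, so the shift produces the factor j + r + 1, which
      is exactly the shifted denominator. The same cancellation closes the next two
      relations.\<close>
    also have "(\<lambda>j. (real j + real (Suc r)) * (1 / (real (Suc j) + real r))) = (\<lambda>_. 1)"
      by (auto simp: field_simps)
    finally show ?thesis by simp
  qed
  then have A0: "real r * A 0 = p" by simp
  have "measure_pmf.expectation P (\<lambda>j. real r / (real j + real r)) = real r * A 0"
    unfolding A_def by (simp flip: integral_mult_right_zero)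
  with A0 show "measure_pmf.expectation P (\<lambda>j. real r / (real j + real r)) = p"
    by simp

  have A1: "A 0 - real r * B = (1 - p) * A 1"
  proof -
    have "A 0 - real r * B
        = measure_pmf.expectation P (\<lambda>j. 1 / (real j + real r) - real r * (1 / (real j + real r)\<^sup>2))"
      unfolding A_def B_def by (subst Bochner_Integration.integral_diff) (simp_all del: times_divide_eq_right)
    also have "\<dots> = measure_pmf.expectation P (\<lambda>j. real j * (1 / (real j + real r)\<^sup>2))"
    proof (intro Bochner_Integration.integral_cong refl)
      fix j
      have "1 / y - real r * (1 / y\<^sup>2) = (y - real r) * (1 / y\<^sup>2)" if "y > 0" for y :: real
        using that by (simp add: field_simps power2_eq_square)
      from this[of "real j + real r"] pos[of j]
      show "1 / (real j + real r) - real r * (1 / (real j + real r)\<^sup>2) = real j * (1 / (real j + real r)\<^sup>2)"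
        by (simp del: times_divide_eq_right)
    qed
    also have "\<dots> = (1 - p) * measure_pmf.expectation P (\<lambda>j. (real j + real (Suc r)) * (1 / (real (Suc j) + real r)\<^sup>2))"
    proof (intro shift)
      fix j
      have "real j * 1 \<le> (real j + real r) * (real j + real r)"
        using pos by (intro mult_mono) auto
      then show "\<bar>real j * (1 / (real j + real r)\<^sup>2)\<bar> \<le> 1"
        by (intro quot) (simp_all add: power2_eq_square)
      have "real (Suc j) + real r = real j + real (Suc r)" by simp
      then show "\<bar>(real j + real (Suc r)) * (1 / (real (Suc j) + real r)\<^sup>2)\<bar> \<le> 1"
        by (simp only:) (simp add: power2_eq_square)
    qed
    also have "(\<lambda>j. (real j + real (Suc r)) * (1 / (real (Suc j) + real r)\<^sup>2)) = (\<lambda>j. 1 / (real j + real r + 1))"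
      by (rule ext) (simp add: power2_eq_square add_ac)
    finally show ?thesis by (simp add: A_def)
  qed

  have A2: "(1 + real r) * A 1 - real r * A 0 = (1 - p) * A 2"
  proof -
    have "(1 + real r) * A 1 - real r * A 0
        = measure_pmf.expectation P (\<lambda>j. (1 + real r) * (1 / (real j + real r + 1)) - real r * (1 / (real j + real r)))"
      unfolding A_def by (subst Bochner_Integration.integral_diff) (simp_all del: times_divide_eq_right)
    \<comment> \<open>Partial fractions: (1 + r) / (x + 1) - r / x = (x - r) / (x (x + 1)) with x =
      j + r.\<close>
    also have "\<dots> = measure_pmf.expectation P (\<lambda>j. real j * (1 / ((real j + real r) * (real j + real r + 1))))"
      using r by (intro Bochner_Integration.integral_cong) (auto simp: divide_simps, auto simp: algebra_simps)
    also have "\<dots> = (1 - p) * measure_pmf.expectation P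
        (\<lambda>j. (real j + real (Suc r)) * (1 / ((real (Suc j) + real r) * (real (Suc j) + real r + 1))))"
    proof (intro shift)
      fix j
      have "real j * 1 \<le> (real j + real r) * (real j + real r + 1)"
        using pos by (intro mult_mono) auto
      then show "\<bar>real j * (1 / ((real j + real r) * (real j + real r + 1)))\<bar> \<le> 1"
        by (intro quot) (simp_all add: power2_eq_square)
      have "real (Suc j) + real r = real j + real (Suc r)" by simp
      then show "\<bar>(real j + real (Suc r)) * (1 / ((real (Suc j) + real r) * (real (Suc j) + real r + 1)))\<bar> \<le> 1"
        by (simp only:) simp
    qed
    also have "(\<lambda>j. (real j + real (Suc r)) * (1 / ((real (Suc j) + real r) * (real (Suc j) + real r + 1))))
        = (\<lambda>j. 1 / (real j + real r + 2))"
      by (rule ext) (simp add: add_ac)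
    finally show ?thesis by (simp add: A_def)
  qed

  \<comment> \<open>The second difference of 1 / x is 2 / (x (x + 1) (x + 2)), positive for x > 0.
    The summand 0 only matches the shape of \<open>A 0\<close>.\<close>
  have "0 \<le> measure_pmf.expectation P
      (\<lambda>j. 1 / (real j + real r + 0) - 2 * (1 / (real j + real r + 1)) + 1 / (real j + real r + 2))"
    using r by (intro Bochner_Integration.integral_nonneg) (simp add: divide_simps, simp add: algebra_simps)
  also have "\<dots> = A 0 - 2 * A 1 + A 2"
    unfolding A_def
    by (subst Bochner_Integration.integral_add; (subst Bochner_Integration.integral_diff)?) (simp_all del: times_divide_eq_right)
  \<comment> \<open>The factor 1 - p is what allows \<open>A2\<close> to replace the third moment by
    the first two.\<close>
  finally have "0 \<le> (1 - p) * (A 0 - 2 * A 1 + A 2)"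
    using p by simp
  then have "0 \<le> (1 - p) * A 0 - 2 * (1 - p) * A 1 + ((1 + real r) * A 1 - real r * A 0)"
    unfolding A2 by (simp add: algebra_simps)
  then have "0 \<le> (real r - 1 + 2 * p) * A 1 - (real r - 1 + p) * A 0"
    by (simp add: algebra_simps)
  \<comment> \<open>This factor creates the products (1 - p) * \<open>A 1\<close> and r *
    \<open>A 0\<close>; the former is rewritten by the relation \<open>A1\<close>, the latter has
    the value p. Only \<open>B\<close> then remains unknown.\<close>
  then have "0 \<le> (1 - p) * real r * ((real r - 1 + 2 * p) * A 1 - (real r - 1 + p) * A 0)"
    using p by (intro mult_nonneg_nonneg) auto
  also have "\<dots> = real r * (real r - 1 + 2 * p) * ((1 - p) * A 1) - (1 - p) * (real r - 1 + p) * (real r * A 0)"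
    by (simp add: algebra_simps)
  also have "\<dots> = (real r - 1 + 2 * p) * (real r * A 0 - (real r)\<^sup>2 * B) - (1 - p) * (real r - 1 + p) * (real r * A 0)"
    unfolding A1[symmetric] by (simp add: algebra_simps power2_eq_square)
  also have "\<dots> = p\<^sup>2 * (real r + p) - (real r - 1 + 2 * p) * ((real r)\<^sup>2 * B)"
    unfolding A0 by (simp add: algebra_simps power2_eq_square)
  finally have "((real r)\<^sup>2 * B) * (real r - 1 + 2 * p) \<le> p\<^sup>2 * (real r + p)"
    by (simp add: mult.commute)
  then have "(real r)\<^sup>2 * B \<le> p\<^sup>2 * (real r + p) / (real r - 1 + 2 * p)"
    using p r by (subst pos_le_divide_eq) auto
  moreover have "measure_pmf.expectation P (\<lambda>j. (real r / (real j + real r))\<^sup>2) = (real r)\<^sup>2 * B"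
    unfolding B_def by (simp add: power_divide flip: integral_mult_right_zero)
  ultimately show "measure_pmf.expectation P (\<lambda>j. (real r / (real j + real r))\<^sup>2)
         \<le> p\<^sup>2 * (real r + p) / (real r - 1 + 2 * p)"
    by simp
qed

section \<open>The law of the number of samples until the k-th occurrence\<close>

lemma samples_until_eqI:
  assumes "card {i. i < m \<and> x i = b} = r" "x m = b"
  shows "samples_until b (Suc r) x = Suc m"
  unfolding samples_until_def
proof (rule Least_equality)
  have "{i. i < Suc m \<and> x i = b} = insert m {i. i < m \<and> x i = b}"
    using assms by (auto simp: less_Suc_eq)
  then show "card {i. i < Suc m \<and> x i = b} = Suc r"
    using assms by simp
next
  fix n assume n: "card {i. i < n \<and> x i = b} = Suc r"
  \<comment> \<open>Counts grow with the length of the prefix, so any prefix of length at most m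
    contains at most r occurrences.\<close>
  show "Suc m \<le> n"
  proof (rule ccontr)
    assume "\<not> Suc m \<le> n"
    then have "card {i. i < n \<and> x i = b} \<le> card {i. i < m \<and> x i = b}"
      by (intro card_mono) auto
    then show False using n assms by simp
  qed
qed

text \<open>As sums of indicators, counts inherit measurability and independence from the general
  facts about finite sums.\<close>

lemma card_Collect_eq_sum_of_bool:
  "real (card {i. i < n \<and> x i = b}) = (\<Sum>i<n. of_bool (x i = b))" for n :: nat
  by (simp add: of_bool_def sum.If_cases) (simp add: lessThan_def Int_def)

text \<open>Measurability on the space of whole sequences lets the independence of the two sequences
  pass to the two sample numbers.\<close>

lemma measurable_samples_until [measurable]:
  "samples_until b k \<in> (\<Pi>\<^sub>M i\<in>UNIV. count_space UNIV) \<rightarrow>\<^sub>M count_space UNIV"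
proof -
  have "Measurable.pred (\<Pi>\<^sub>M i\<in>UNIV. count_space UNIV)
      (\<lambda>x :: nat \<Rightarrow> bool. card {i. i < n \<and> x i = b} = k)" for n
  proof -
    have "(card {i. i < n \<and> x i = b} = k)
        \<longleftrightarrow> (\<Sum>i<n. of_bool (x i = b)) = real k" for x :: "nat \<Rightarrow> bool"
      by (simp flip: card_Collect_eq_sum_of_bool)
    then show ?thesis by (simp only:) measurable
  qed
  then show ?thesis
    unfolding samples_until_def[abs_def] by measurable
qed

text \<open>Summing the point masses gives Q(A) \<le> D(A) for every set A, where D is the law of
  \<open>N\<close>. The same bound for the complement of A reverses the inequality, since both
  measures have total mass 1.\<close>

lemma (in prob_space) distr_eq_measure_pmfI:
  fixes N :: "'a \<Rightarrow> 'b :: countable"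
  assumes [measurable]: "N \<in> M \<rightarrow>\<^sub>M count_space UNIV"
    and le: "\<And>n. pmf Q n \<le> prob {\<omega> \<in> space M. N \<omega> = n}"
  shows "distr M (count_space UNIV) N = measure_pmf Q"
proof -
  let ?D = "distr M (count_space UNIV) N"
  interpret D: prob_space ?D by (rule prob_space_distr) fact
  have le': "measure_pmf.prob Q A \<le> D.prob A" for A
  proof -
    have "emeasure Q A = (\<integral>\<^sup>+x. emeasure Q {x} \<partial>count_space A)"
      by (rule emeasure_countable_singleton) auto
    also have "\<dots> \<le> (\<integral>\<^sup>+x. emeasure ?D {x} \<partial>count_space A)"
    proof (rule nn_integral_mono)
      fix x
      have "{\<omega> \<in> space M. N \<omega> = x} = N -` {x} \<inter> space M" by auto
      then show "emeasure Q {x} \<le> emeasure ?D {x}"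
        using le[of x]
        by (simp add: emeasure_distr emeasure_eq_measure emeasure_pmf_single)
    qed
    also have "\<dots> = emeasure ?D A"
      by (rule emeasure_countable_singleton[symmetric]) auto
    finally show ?thesis
      by (simp add: D.emeasure_eq_measure measure_pmf.emeasure_eq_measure)
  qed
  have "measure_pmf.prob Q A = D.prob A" for A
    using le'[of A] le'[of "- A"] D.prob_compl[of A] measure_pmf.prob_compl[of A Q]
    by (simp add: Compl_eq_Diff_UNIV)
  then show ?thesis
    by (intro measure_eqI) (auto simp: D.emeasure_eq_measure measure_pmf.emeasure_eq_measure)
qed

context prob_space
begin

text \<open>With \<theta> the probability of the outcome \<open>b\<close>, a single development
  serves both the successes behind \<open>N1\<close> and the failures behind
  \<open>N2\<close>.\<close>

context
  fixes X :: "nat \<Rightarrow> 'a \<Rightarrow> bool" and p \<theta> :: real and b :: bool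
  assumes p: "0 < p" "p < 1" and iid: "iid_bernoulli M p X"
    and \<theta>: "\<theta> = (if b then p else 1 - p)"
begin

lemma measurable_iid [measurable]: "X i \<in> M \<rightarrow>\<^sub>M count_space UNIV"
  using iid unfolding iid_bernoulli_def indep_vars_def by auto

lemma prob_iid_eq: "prob {\<omega> \<in> space M. X i \<omega> = c} = (if c = b then \<theta> else 1 - \<theta>)"
proof -
  have "prob {\<omega> \<in> space M. X i \<omega> = c} = measure (distr M (count_space UNIV) (X i)) {c}"
    by (subst measure_distr) (auto intro!: arg_cong[where f = prob])
  also have "\<dots> = pmf (bernoulli_pmf p) c"
    using iid unfolding iid_bernoulli_def by (simp add: measure_pmf_single)
  finally show ?thesis
    using p by (cases c; cases b) (auto simp: \<theta>)
qed

text \<open>The count involves only samples before index m, so it is independent of sample m.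
  Independence is applied to the indicator of sample m and the sum of the earlier
  indicators.\<close>

lemma prob_count_and_next:
  "prob {\<omega> \<in> space M. card {i. i < m \<and> X i \<omega> = b} = j \<and> X m \<omega> = c}
    = prob {\<omega> \<in> space M. card {i. i < m \<and> X i \<omega> = b} = j} * (if c = b then \<theta> else 1 - \<theta>)"
proof -
  let ?Z = "\<lambda>i \<omega>. of_bool (X i \<omega> = b) :: real"
  have "indep_vars (\<lambda>_. borel) ?Z UNIV"
    using iid unfolding iid_bernoulli_def
    by (intro indep_vars_compose2[where X = X and Y = "\<lambda>_ v. of_bool (v = b)"
          and M' = "\<lambda>_. count_space UNIV"]) auto
  then have "indep_vars (\<lambda>_. borel) ?Z (insert m {..<m})"
    by (rule indep_vars_subset) auto
  then have "indep_var borel (?Z m) borel (\<lambda>\<omega>. \<Sum>i<m. ?Z i \<omega>)"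
    by (intro indep_vars_sum) auto
  from indep_varD[OF this, of "{of_bool (c = b)}" "{real j}"]
  have "prob ((\<lambda>\<omega>. (?Z m \<omega>, \<Sum>i<m. ?Z i \<omega>)) -` ({of_bool (c = b)} \<times> {real j}) \<inter> space M)
    = prob (?Z m -` {of_bool (c = b)} \<inter> space M) * prob ((\<lambda>\<omega>. \<Sum>i<m. ?Z i \<omega>) -` {real j} \<inter> space M)"
    by simp
  moreover have "(\<lambda>\<omega>. (?Z m \<omega>, \<Sum>i<m. ?Z i \<omega>)) -` ({of_bool (c = b)} \<times> {real j}) \<inter> space M
      = {\<omega> \<in> space M. card {i. i < m \<and> X i \<omega> = b} = j \<and> X m \<omega> = c}"
    unfolding card_Collect_eq_sum_of_bool[symmetric] by auto
  moreover have "?Z m -` {of_bool (c = b)} \<inter> space M = {\<omega> \<in> space M. X m \<omega> = c}"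
    by auto
  moreover have "(\<lambda>\<omega>. \<Sum>i<m. ?Z i \<omega>) -` {real j} \<inter> space M
      = {\<omega> \<in> space M. card {i. i < m \<and> X i \<omega> = b} = j}"
    unfolding card_Collect_eq_sum_of_bool[symmetric] by auto
  ultimately show ?thesis
    by (simp add: prob_iid_eq)
qed

lemma pred_count [measurable]: "Measurable.pred M (\<lambda>\<omega>. card {i. i < m \<and> X i \<omega> = b} = j)"
proof -
  have "(card {i. i < m \<and> X i \<omega> = b} = j) \<longleftrightarrow> (\<Sum>i<m. of_bool (X i \<omega> = b)) = real j" for \<omega>
    by (simp flip: card_Collect_eq_sum_of_bool)
  then show ?thesis by (simp only:) measurable
qed

text \<open>Conditioning on the last sample turns the induction step into Pascal's rule.\<close>

lemma prob_count:
  "prob {\<omega> \<in> space M. card {i. i < m \<and> X i \<omega> = b} = j} = real (m choose j) * \<theta> ^ j * (1 - \<theta>) ^ (m - j)"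
proof (induction m arbitrary: j)
  case 0
  then show ?case by (cases j) (auto simp: prob_space)
next
  case (Suc m)
  let ?C = "\<lambda>m \<omega>. card {i. i < m \<and> X i \<omega> = b}"
  have step: "?C (Suc m) \<omega> = (if X m \<omega> = b then Suc (?C m \<omega>) else ?C m \<omega>)" for \<omega>
  proof -
    have "{i. i < Suc m \<and> X i \<omega> = b}
        = (if X m \<omega> = b then insert m {i. i < m \<and> X i \<omega> = b} else {i. i < m \<and> X i \<omega> = b})"
      by (auto simp: less_Suc_eq)
    then show ?thesis by simp
  qed
  show ?case
  proof (cases j)
    case 0
    have "{\<omega> \<in> space M. ?C (Suc m) \<omega> = j} = {\<omega> \<in> space M. ?C m \<omega> = 0 \<and> X m \<omega> = (\<not> b)}"
      unfolding step 0 by auto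
    then show ?thesis
      by (simp only: prob_count_and_next Suc.IH) (simp add: 0)
  next
    case (Suc l)
    have "{\<omega> \<in> space M. ?C (Suc m) \<omega> = j} = {\<omega> \<in> space M. ?C m \<omega> = l \<and> X m \<omega> = b} \<union>
        {\<omega> \<in> space M. ?C m \<omega> = Suc l \<and> X m \<omega> = (\<not> b)}"
      unfolding step Suc by (auto split: if_splits)
    then have "prob {\<omega> \<in> space M. ?C (Suc m) \<omega> = j} = prob {\<omega> \<in> space M. ?C m \<omega> = l \<and> X m \<omega> = b} +
        prob {\<omega> \<in> space M. ?C m \<omega> = Suc l \<and> X m \<omega> = (\<not> b)}"
      by (simp only:) (rule finite_measure_Union; auto)
    also have "\<dots> = real (m choose l) * \<theta> ^ l * (1 - \<theta>) ^ (m - l) * \<theta>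
        + real (m choose Suc l) * \<theta> ^ Suc l * (1 - \<theta>) ^ (m - Suc l) * (1 - \<theta>)"
      by (simp only: prob_count_and_next Suc.IH) simp
    \<comment> \<open>Truncated subtraction breaks the exponent rule when m < \<open>Suc l\<close>,
      but then the binomial coefficient is 0.\<close>
    also have "real (m choose Suc l) * \<theta> ^ Suc l * (1 - \<theta>) ^ (m - Suc l) * (1 - \<theta>)
        = real (m choose Suc l) * \<theta> ^ Suc l * (1 - \<theta>) ^ (m - l)"
      by (cases "Suc l \<le> m") (simp_all add: Suc_diff_Suc[symmetric] binomial_eq_0)
    finally show ?thesis
      by (simp add: Suc algebra_simps)
  qed
qed

lemma measurable_samples_until_iid:
  "(\<lambda>\<omega>. samples_until b k (\<lambda>i. X i \<omega>)) \<in> M \<rightarrow>\<^sub>M count_space UNIV"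
proof (rule measurable_compose[OF _ measurable_samples_until])
  show "(\<lambda>\<omega> i. X i \<omega>) \<in> M \<rightarrow>\<^sub>M (\<Pi>\<^sub>M i\<in>UNIV. count_space UNIV)"
    by (rule measurable_PiM_single') auto
qed

text \<open>
  Only the inequality between the point masses is checked: it forces equality since both sides are
  probability measures, so the junk value of \<^const>\<open>samples_until\<close> on sequences with too few
  occurrences plays no role. The mass bound at \<open>j + Suc r\<close> comes from the event that there are
  exactly \<open>r\<close> occurrences among the first \<open>j + r\<close> samples and one more at index \<open>j + r\<close>.
\<close>
lemma distr_samples_until:
  "distr M (count_space UNIV) (\<lambda>\<omega>. samples_until b (Suc r) (\<lambda>i. X i \<omega>))
    = measure_pmf (map_pmf (\<lambda>j. j + Suc r) (neg_binomial_pmf (Suc r) \<theta>))"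
proof (rule distr_eq_measure_pmfI)
  show "(\<lambda>\<omega>. samples_until b (Suc r) (\<lambda>i. X i \<omega>)) \<in> M \<rightarrow>\<^sub>M count_space UNIV"
    by (rule measurable_samples_until_iid)
  note [measurable] = this
  fix n
  show "pmf (map_pmf (\<lambda>j. j + Suc r) (neg_binomial_pmf (Suc r) \<theta>)) n
    \<le> prob {\<omega> \<in> space M. samples_until b (Suc r) (\<lambda>i. X i \<omega>) = n}"
  proof (cases "n \<ge> Suc r")
    case True
    then obtain j where n: "n = j + Suc r"
      by (metis le_add_diff_inverse2)
    have "pmf (map_pmf (\<lambda>j. j + Suc r) (neg_binomial_pmf (Suc r) \<theta>)) n = pmf (neg_binomial_pmf (Suc r) \<theta>) j"
      unfolding n by (rule pmf_map_inj') (auto simp: inj_def)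
    \<comment> \<open>The last factor \<theta> is split off for the sample at index j + r; the rest
      is the binomial probability of r occurrences before it.\<close>
    also have "\<dots> = real ((j + r) choose r) * \<theta> ^ r * (1 - \<theta>) ^ j * \<theta>"
      using p binomial_symmetric[of j "j + r"] by (subst pmf_neg_binomial) (auto simp: \<theta>)
    also have "\<dots> = prob {\<omega> \<in> space M. card {i. i < j + r \<and> X i \<omega> = b} = r \<and> X (j + r) \<omega> = b}"
      by (simp add: prob_count_and_next prob_count)
    also have "\<dots> \<le> prob {\<omega> \<in> space M. samples_until b (Suc r) (\<lambda>i. X i \<omega>) = n}"
      unfolding n by (intro finite_measure_mono) (auto dest: samples_until_eqI)
    finally show ?thesis .
  next
    case False
    then have "n \<notin> set_pmf (map_pmf (\<lambda>j. j + Suc r) (neg_binomial_pmf (Suc r) \<theta>))"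
      by auto
    then show ?thesis by (simp only: set_pmf_iff not_not measure_nonneg)
  qed
qed

lemma
  fixes f :: "nat \<Rightarrow> real"
  shows integrable_samples_until_iff:
      "integrable M (\<lambda>\<omega>. f (samples_until b (Suc r) (\<lambda>i. X i \<omega>)))
        \<longleftrightarrow> integrable (neg_binomial_pmf (Suc r) \<theta>) (\<lambda>j. f (j + Suc r))"
    and expectation_samples_until:
      "expectation (\<lambda>\<omega>. f (samples_until b (Suc r) (\<lambda>i. X i \<omega>)))
        = measure_pmf.expectation (neg_binomial_pmf (Suc r) \<theta>) (\<lambda>j. f (j + Suc r))"
proof -
  note meas = measurable_samples_until_iid[of "Suc r"]
  show "integrable M (\<lambda>\<omega>. f (samples_until b (Suc r) (\<lambda>i. X i \<omega>)))
        \<longleftrightarrow> integrable (neg_binomial_pmf (Suc r) \<theta>) (\<lambda>j. f (j + Suc r))"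
    using integrable_distr_eq[OF meas, of f] by (simp add: distr_samples_until)
  show "expectation (\<lambda>\<omega>. f (samples_until b (Suc r) (\<lambda>i. X i \<omega>)))
        = measure_pmf.expectation (neg_binomial_pmf (Suc r) \<theta>) (\<lambda>j. f (j + Suc r))"
    using integral_distr[OF meas, of f] by (simp add: distr_samples_until)
qed

end

end

section \<open>Unbiasedness, variance and expected sample size of the estimator\<close>

theorem theorem1:
  fixes M :: "'a measure" and X Y :: "nat \<Rightarrow> 'a \<Rightarrow> bool"
    and r :: nat and p \<gamma> :: real
    and N1 N2 N :: "'a \<Rightarrow> nat" and \<gamma>_hat :: "'a \<Rightarrow> real"
  assumes "prob_space M"
    and "r \<ge> 2"
    and "0 < p" and "p < 1"
    and "\<gamma> = p / (1 - p)"
    and "iid_bernoulli M p X" and "iid_bernoulli M p Y"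
    and "indep_seqs M X Y"
    and "\<And>\<omega>. N1 \<omega> = samples_until True (r + 1) (\<lambda>i. X i \<omega>)"
    and "\<And>\<omega>. N2 \<omega> = samples_until False (r - 1) (\<lambda>i. Y i \<omega>)"
    and "\<And>\<omega>. \<gamma>_hat \<omega> =
          real r / (real (N1 \<omega>) - 1) * (real (N2 \<omega>) / (real r - 1))"
    and "\<And>\<omega>. N \<omega> = N1 \<omega> + N2 \<omega>"
  shows "integrable M \<gamma>_hat \<and>
        prob_space.expectation M \<gamma>_hat = \<gamma> \<and>
        integrable M (\<lambda>\<omega>. (\<gamma>_hat \<omega>)\<^sup>2) \<and>
        prob_space.variance M \<gamma>_hat / \<gamma>\<^sup>2
          \<le> 1 / (real r - 1) * (1 - p * (1 - p) / (real r - 1 + 2 * p)) \<and>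
        1 / (real r - 1) * (1 - p * (1 - p) / (real r - 1 + 2 * p)) < 1 / (real r - 1) \<and>
        integrable M (\<lambda>\<omega>. real (N \<omega>)) \<and>
        prob_space.expectation M (\<lambda>\<omega>. real (N \<omega>)) = (real r + 1 - 2 * p) / (p * (1 - p))"
proof -
  interpret prob_space M by fact
  \<comment> \<open>The law of the sample number is available for a count of the form
    \<open>Suc r\<close>, so r - 1 > 0 is written as a successor.\<close>
  obtain l where l: "r - 1 = Suc l"
    using \<open>r \<ge> 2\<close> by (cases "r - 1") auto
  have r1: "real r - 1 = real (Suc l)" "r > 0" "r \<ge> 1"
    using l by auto
  have p: "p \<in> {0<..1}" "1 - p \<in> {0<..1}" "0 < p" "p < 1"
    using assms by auto
  have N1: "N1 = (\<lambda>\<omega>. samples_until True (Suc r) (\<lambda>i. X i \<omega>))"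
    and N2: "N2 = (\<lambda>\<omega>. samples_until False (Suc l) (\<lambda>i. Y i \<omega>))"
    using assms(9,10) l by auto
  note int1 = integrable_samples_until_iff[OF p(3,4) assms(6), of p True, simplified, where r = r, folded fun_cong[OF N1]]
    and exp1 = expectation_samples_until[OF p(3,4) assms(6), of p True, simplified, where r = r, folded fun_cong[OF N1]]
    and int2 = integrable_samples_until_iff[OF p(3,4) assms(7), of "1 - p" False, simplified, where r = l, folded fun_cong[OF N2]]
    and exp2 = expectation_samples_until[OF p(3,4) assms(7), of "1 - p" False, simplified, where r = l, folded fun_cong[OF N2]]

  define A where "A \<omega> = real r / (real (N1 \<omega>) - 1)" for \<omega>
  define B where "B \<omega> = real (N2 \<omega>) / (real r - 1)" for \<omega>
  have hat: "\<gamma>_hat = (\<lambda>\<omega>. A \<omega> * B \<omega>)"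
    using assms(11) by (auto simp: A_def B_def)

  \<comment> \<open>With j failures before the last success, N_1 = j + r + 1, so N_1 - 1 is the
    denominator j + r of the reciprocal moments.\<close>
  have shift1: "real (Suc (j + r)) - 1 = real j + real r" for j
    by simp
  have quot: "\<bar>real r / (real j + real r)\<bar> \<le> 1" for j
    using r1 by auto
  have quot2: "\<bar>(real r / (real j + real r))\<^sup>2\<bar> \<le> 1" for j
    using power_le_one[of "\<bar>real r / (real j + real r)\<bar>" 2] quot[of j] by (simp only: power2_abs abs_power2)
  have iA: "integrable M A"
    unfolding A_def int1[where f = "\<lambda>n. real r / (real n - 1)"] shift1
    using quot by (intro measure_pmf.integrable_const_bound[where B = 1]) auto
  have iA2: "integrable M (\<lambda>\<omega>. (A \<omega>)\<^sup>2)"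
    unfolding A_def int1[where f = "\<lambda>n. (real r / (real n - 1))\<^sup>2"] shift1
    using quot2 by (intro measure_pmf.integrable_const_bound[where B = 1]) auto
  have eA: "expectation A = p"
    unfolding A_def exp1[where f = "\<lambda>n. real r / (real n - 1)"] shift1
    by (rule expectation_inverse_trials) (use p r1 in auto)
  have eA2: "expectation (\<lambda>\<omega>. (A \<omega>)\<^sup>2) \<le> p\<^sup>2 * (real r + p) / (real r - 1 + 2 * p)"
    unfolding A_def exp1[where f = "\<lambda>n. (real r / (real n - 1))\<^sup>2"] shift1
    by (rule expectation_inverse_trials_square_le) (use p r1 in auto)

  have shift2: "real (Suc (j + l)) = real j + real (Suc l)" for j
    by simp
  have iN2: "integrable M (\<lambda>\<omega>. real (N2 \<omega>))"
    unfolding int2[where f = real] shift2 by (intro integrable_neg_binomial_trials p) simp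
  have eN2: "expectation (\<lambda>\<omega>. real (N2 \<omega>)) = (real r - 1) / (1 - p)"
    unfolding exp2[where f = real] shift2 r1 by (intro expectation_neg_binomial_trials p) simp
  have iN2': "integrable M (\<lambda>\<omega>. (real (N2 \<omega>))\<^sup>2)"
    unfolding int2[where f = "\<lambda>n. (real n)\<^sup>2"] shift2 by (intro integrable_neg_binomial_trials_square p) simp
  have "expectation (\<lambda>\<omega>. (real (N2 \<omega>))\<^sup>2) = real (Suc l) * (real (Suc l) + 1 - (1 - p)) / (1 - p)\<^sup>2"
    unfolding exp2[where f = "\<lambda>n. (real n)\<^sup>2"] shift2
    by (intro expectation_neg_binomial_trials_square p) simp
  then have eN2': "expectation (\<lambda>\<omega>. (real (N2 \<omega>))\<^sup>2) = (real r - 1) * (real r - 1 + p) / (1 - p)\<^sup>2"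
    by (simp add: r1)
  have iB: "integrable M B" and eB: "expectation B = 1 / (1 - p)"
    using iN2 eN2 r1 unfolding B_def by simp_all
  have iB2: "integrable M (\<lambda>\<omega>. (B \<omega>)\<^sup>2)"
    using iN2' unfolding B_def power_divide by simp
  have "expectation (\<lambda>\<omega>. (B \<omega>)\<^sup>2)
      = (real r - 1) * (real r - 1 + p) / (1 - p)\<^sup>2 / (real r - 1)\<^sup>2"
    unfolding B_def power_divide by (simp add: eN2')
  moreover have "s * (s + p) / c / s\<^sup>2 = (s + p) / (s * c)" if "s > 0" for s c :: real
    using that by (simp add: power2_eq_square)
  ultimately have eB2: "expectation (\<lambda>\<omega>. (B \<omega>)\<^sup>2) = (real r - 1 + p) / ((real r - 1) * (1 - p)\<^sup>2)"
    unfolding r1 by simp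

  have iN1: "integrable M (\<lambda>\<omega>. real (N1 \<omega>))"
    and eN1: "expectation (\<lambda>\<omega>. real (N1 \<omega>)) = (real r + 1) / p"
    using integrable_neg_binomial_trials[OF p(1), of "Suc r"]
      expectation_neg_binomial_trials[OF p(1), of "Suc r"]
    by (simp_all add: int1[where f = real] exp1[where f = real] add_ac)

  \<comment> \<open>Each factor of the estimator is a measurable function of one whole sequence, so
    the factors, and then their squares, are independent and their expectations multiply.\<close>
  have "indep_var borel ((\<lambda>x. real r / (real (samples_until True (Suc r) x) - 1)) \<circ> (\<lambda>\<omega> i. X i \<omega>))
      borel ((\<lambda>x. real (samples_until False (Suc l) x) / (real r - 1)) \<circ> (\<lambda>\<omega> i. Y i \<omega>))"
    using \<open>indep_seqs M X Y\<close> unfolding indep_seqs_def by (rule indep_var_compose) measurable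
  then have indep: "indep_var borel A borel B"
    by (simp add: A_def[abs_def] B_def[abs_def] N1 N2 comp_def)
  have "indep_var borel ((\<lambda>x. x\<^sup>2) \<circ> A) borel ((\<lambda>x. x\<^sup>2) \<circ> B)"
    using indep by (rule indep_var_compose) measurable
  then have indep2: "indep_var borel (\<lambda>\<omega>. (A \<omega>)\<^sup>2) borel (\<lambda>\<omega>. (B \<omega>)\<^sup>2)"
    by (simp add: comp_def)

  have i: "integrable M \<gamma>_hat"
    unfolding hat by (rule indep_var_integrable[OF indep iA iB])
  have i2: "integrable M (\<lambda>\<omega>. (\<gamma>_hat \<omega>)\<^sup>2)"
    unfolding hat power_mult_distrib by (rule indep_var_integrable[OF indep2 iA2 iB2])
  have e: "expectation \<gamma>_hat = \<gamma>"
    unfolding hat assms(5) by (simp add: indep_var_lebesgue_integral[OF indep iA iB] eA eB)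
  have "expectation (\<lambda>\<omega>. (\<gamma>_hat \<omega>)\<^sup>2)
      = expectation (\<lambda>\<omega>. (A \<omega>)\<^sup>2) * ((real r - 1 + p) / ((real r - 1) * (1 - p)\<^sup>2))"
    unfolding hat power_mult_distrib
    by (simp add: indep_var_lebesgue_integral[OF indep2 iA2 iB2] eB2)
  also have "\<dots> \<le> p\<^sup>2 * (real r + p) / (real r - 1 + 2 * p) * ((real r - 1 + p) / ((real r - 1) * (1 - p)\<^sup>2))"
    using p by (intro mult_right_mono eA2) (simp add: r1)
  also have "\<dots> = \<gamma>\<^sup>2 * ((real r + p) * (real r - 1 + p) / ((real r - 1 + 2 * p) * (real r - 1)))"
    by (simp add: assms(5) power_divide mult_ac)
  finally have *: "expectation (\<lambda>\<omega>. (\<gamma>_hat \<omega>)\<^sup>2) \<le> \<dots>" .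
  have "\<gamma> > 0"
    using p by (simp add: assms(5))
  then have "expectation (\<lambda>\<omega>. (\<gamma>_hat \<omega>)\<^sup>2) / \<gamma>\<^sup>2
      \<le> (real r + p) * (real r - 1 + p) / ((real r - 1 + 2 * p) * (real r - 1))"
    using * by (simp add: pos_divide_le_eq mult.commute)
  moreover have "variance \<gamma>_hat / \<gamma>\<^sup>2 = expectation (\<lambda>\<omega>. (\<gamma>_hat \<omega>)\<^sup>2) / \<gamma>\<^sup>2 - 1"
    using \<open>\<gamma> > 0\<close> by (subst variance_eq[OF i i2]) (simp add: e diff_divide_distrib)
  \<comment> \<open>With s = r - 1, both sides equal (s + p + p^2) / (s (s + 2 p)). The bound on the
    second moment of \<open>A\<close> is thus the only inequality behind the variance
    estimate.\<close>
  moreover have "(real r + p) * (real r - 1 + p) / ((real r - 1 + 2 * p) * (real r - 1)) - 1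
      = 1 / (real r - 1) * (1 - p * (1 - p) / (real r - 1 + 2 * p))"
  proof -
    have "(s + 1 + p) * (s + p) / ((s + 2 * p) * s) - 1 = 1 / s * (1 - p * (1 - p) / (s + 2 * p))"
      if "s > 0" for s :: real
    proof -
      have "s + 2 * p \<noteq> 0" "s \<noteq> 0" using that p by auto
      then show ?thesis by (simp add: divide_simps) (simp add: algebra_simps)
    qed
    from this[of "real r - 1"] show ?thesis
      using \<open>r \<ge> 2\<close> by simp
  qed
  ultimately have v: "variance \<gamma>_hat / \<gamma>\<^sup>2
      \<le> 1 / (real r - 1) * (1 - p * (1 - p) / (real r - 1 + 2 * p))"
    by linarith

  have "0 < p * (1 - p) / (real r - 1 + 2 * p)"
    unfolding r1 using p by (intro divide_pos_pos mult_pos_pos) auto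
  then have lt: "1 / (real r - 1) * (1 - p * (1 - p) / (real r - 1 + 2 * p)) < 1 / (real r - 1)"
    using mult_strict_left_mono[of "1 - p * (1 - p) / (real r - 1 + 2 * p)" 1 "1 / (real r - 1)"] r1 by simp

  have N: "(\<lambda>\<omega>. real (N \<omega>)) = (\<lambda>\<omega>. real (N1 \<omega>) + real (N2 \<omega>))"
    using assms(12) by simp
  have iN: "integrable M (\<lambda>\<omega>. real (N \<omega>))"
    unfolding N using iN1 iN2 by simp
  have "expectation (\<lambda>\<omega>. real (N \<omega>)) = (real r + 1) / p + (real r - 1) / (1 - p)"
    unfolding N using iN1 iN2 by (simp add: eN1 eN2)
  also have "\<dots> = (real r + 1 - 2 * p) / (p * (1 - p))"
    using p by (simp add: divide_simps) (simp add: algebra_simps)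
  finally show ?thesis
    using i e i2 v lt iN by blast
qed

end
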